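(* For $j\in[p]=\{1,\dots,p\}$ let $h^j=f^j+g^j$ with $f^j:\mathbb{R}^n\to\mathbb{R}^m$ continuously differentiable and $g^j:\mathbb{R}^n\to\mathbb{R}^m\cup\{+\infty_C\}$ proper, closed and $C$-convex, and let $H(x)=\{h^1(x),\dots,h^p(x)\}$. Let $l>0$, $\rho\in(0,1)$, let $\bar y\in\mathrm{dom}(H)$ be a non-stationary point of the set optimization problem $\preceq^\ell$-$\min_{x\in\mathbb{R}^n} H(x)$, and let $$(\bar a^l,\bar v_l)\in\operatorname*{arg\,min}_{(a,v)\in P_{\bar y}\times\mathbb{R}^n}\left\{\max_{j\in[\omega(\bar y)]}\phi\left(\nabla f^{a_j}(\bar y)^\top v+g^{a_j}(\bar y+v)-g^{a_j}(\bar y)\right)+\frac l2\|v\|^2\right\}.$$ Then there exists a non-singleton interval $\bar I\subseteq(0,1]$ such that for all $\alpha\in\bar I$: (i) $h^{\bar a^l_j}(\bar y+\alpha\bar v_l)\preceq_C h^{\bar a^l_j}(\bar y)+\rho\,\alpha\left(\nabla f^{\bar a^l_j}(\bar y)^\top\bar v_l+g^{\bar a^l_j}(\bar y+\bar v_l)-g^{\bar a^l_j}(\bar y)\right)$ for all $j\in[\omega(\bar y)]$; (ii) $H(\bar y+\alpha\bar v_l)\prec^\ell H(\bar y)$.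
   Context: $C\subset\mathbb{R}^m$ is a closed, convex, pointed cone with nonempty interior; $w\preceq_C w'$ iff $w'-w\in C$, $w\prec_C w'$ iff $w'-w\in\mathrm{int}(C)$. The extra element $+\infty_C$ satisfies $w\prec_C+\infty_C$ for all $w\in\mathbb{R}^m$. For sets, $U\prec^\ell V$ iff $V\subseteq U+\mathrm{int}(C)$, i.e. for every $v\in V$ there is $u\in U$ with $u\prec_C v$; $U\preceq^\ell V$ iff $V\subseteq U+C$. $\mathrm{dom}(H):=\{x:h^j(x)\prec_C+\infty_C\ \forall j\in[p]\}$. $C^*=\{z:w^\top z\ge0\ \forall w\in C\}$, $\mathcal{Z}:=\{z\in C^*:\|z\|=1\}$, $\phi(w):=\sup_{z\in\mathcal{Z}}z^\top w$, with $z^\top(+\infty_C):=+\infty$ for $z\in C^*\setminus\{0\}$ and $\phi(+\infty_C):=+\infty$. $\nabla f^j(x)\in\mathbb{R}^{n\times m}$ is the transposed Jacobian. "Non-singleton interval" means a nonempty interval with more than one point. A function $g:\mathbb{R}^n\to\mathbb{R}^m\cup\{+\infty_C\}$ is $C$-convex if $g(\lambda x+(1-\lambda)y)\preceq_C\lambda g(x)+(1-\lambda)g(y)$ for all $x,y$ and $\lambda\in(0,1]$; proper if not identically $+\infty_C$; closed if $x\mapsto z^\top g(x)$ is lower semicontinuous for every $z\in C^*\setminus\{0\}$. Minimal set: $\mathcal{M}(U,C):=\{u\in U:\nexists\,u'\in U,\ u'\ne u,\ u'\preceq_C u\}$; $\omega(x):=|\mathcal{M}(H(x),C)|$, $[\omega(x)]=\{1,\dots,\omega(x)\}$.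 Partition set: enumerate $\mathcal{M}(H(x),C)=\{u_1^x,\dots,u_{\omega(x)}^x\}$ and, with $I_u(x):=\{j\in[p]:h^j(x)=u\}$, put $P_x:=\prod_{j=1}^{\omega(x)}I_{u_j^x}(x)$; elements are written $a=(a_1,\dots,a_{\omega(x)})$. The minimum of $\max_{j\in[\omega(\bar y)]}\phi\left(\nabla f^{a_j}(\bar y)^\top v+g^{a_j}(\bar y+v)-g^{a_j}(\bar y)\right)+\frac l2\|v\|^2$ over $(a,v)\in P_{\bar y}\times\mathbb{R}^n$ is attained. Directional derivative: $D_vh(\bar y):=\lim_{\alpha\to0^+}\frac1\alpha(h(\bar y+\alpha v)-h(\bar y))$ in the extended sense: $D_vh(\bar y)\in-\mathrm{int}(C)$ means $\lim_{\alpha\to0^+}\frac1\alpha z^\top(h(\bar y+\alpha v)-h(\bar y))<0$ in $[-\infty,+\infty]$ for all $z\in C^*\setminus\{0\}$. $\bar y$ is a stationary point if for every $a\in P_{\bar y}$ and every $v\in\mathbb{R}^n$ there is $j\in[\omega(\bar y)]$ with $D_vh^{a_j}(\bar y)\notin-\mathrm{int}(C)$; otherwise it is non-stationary. *)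

theory Defs
  imports "HOL-Analysis.Analysis"
begin

section \<open>The space of vectors extended by a greatest element\<close>

datatype 'a cext = Fin 'a | CInf

fun cadd :: "'a::real_vector cext \<Rightarrow> 'a cext \<Rightarrow> 'a cext" (infixl "\<oplus>" 65) where
  "Fin w \<oplus> Fin w' = Fin (w + w')"
| "Fin w \<oplus> CInf = CInf"
| "CInf \<oplus> _ = CInf"

text \<open>Only differences with a finite subtrahend are meaningful; the value of
  \<open>x \<ominus> CInf\<close> is a dummy.\<close>

fun csub :: "'a::real_vector cext \<Rightarrow> 'a cext \<Rightarrow> 'a cext" (infixl "\<ominus>" 65) where
  "Fin w \<ominus> Fin w' = Fin (w - w')"
| "Fin w \<ominus> CInf = CInf"
| "CInf \<ominus> _ = CInf"

text \<open>Only scalars \<open>c \<ge> 0\<close> occur. The case \<open>c = 0\<close> arises only as the second coefficient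
  of a convex combination with \<open>\<lambda> = 1\<close>; there any convention for \<open>0 \<cdot> CInf\<close> in which the
  result is \<open>0\<close> or \<open>CInf\<close> gives a trivially satisfied inequality.\<close>

fun cscale :: "real \<Rightarrow> 'a::real_vector cext \<Rightarrow> 'a cext" (infixr "\<odot>" 75) where
  "c \<odot> Fin w = Fin (c *\<^sub>R w)"
| "c \<odot> CInf = CInf"

fun cle :: "'a::real_normed_vector cext \<Rightarrow> 'a set \<Rightarrow> 'a cext \<Rightarrow> bool"
    ("(_/ \<preceq>\<^bsub>_\<^esub> _)" [51, 0, 51] 50) where
  "Fin w \<preceq>\<^bsub>C\<^esub> Fin w' \<longleftrightarrow> w' - w \<in> C"
| "x \<preceq>\<^bsub>C\<^esub> CInf \<longleftrightarrow> True"
| "CInf \<preceq>\<^bsub>C\<^esub> Fin w' \<longleftrightarrow> False"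

fun cless :: "'a::real_normed_vector cext \<Rightarrow> 'a set \<Rightarrow> 'a cext \<Rightarrow> bool"
    ("(_/ \<prec>\<^bsub>_\<^esub> _)" [51, 0, 51] 50) where
  "Fin w \<prec>\<^bsub>C\<^esub> Fin w' \<longleftrightarrow> w' - w \<in> interior C"
| "Fin w \<prec>\<^bsub>C\<^esub> CInf \<longleftrightarrow> True"
| "CInf \<prec>\<^bsub>C\<^esub> _ \<longleftrightarrow> False"

definition set_less :: "'a::real_normed_vector cext set \<Rightarrow> 'a set \<Rightarrow> 'a cext set \<Rightarrow> bool"
    ("(_/ \<prec>\<^sup>l\<^bsub>_\<^esub> _)" [51, 0, 51] 50) where
  "U \<prec>\<^sup>l\<^bsub>C\<^esub> V \<longleftrightarrow> (\<forall>v\<in>V. \<exists>u\<in>U. u \<prec>\<^bsub>C\<^esub> v)"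


section \<open>Cones and scalarization\<close>

definition ordering_cone :: "'a::euclidean_space set \<Rightarrow> bool" where
  "ordering_cone C \<longleftrightarrow>
     closed C \<and> convex C \<and> cone C \<and> C \<inter> uminus ` C = {0} \<and> interior C \<noteq> {}"

definition dual_cone :: "'a::euclidean_space set \<Rightarrow> 'a set" where
  "dual_cone C = {z. \<forall>w\<in>C. 0 \<le> w \<bullet> z}"

text \<open>\<open>zdot z x\<close> is \<open>z\<^sup>T x\<close>, used only for nonzero \<open>z\<close> in the dual cone.\<close>

fun zdot :: "'a::euclidean_space \<Rightarrow> 'a cext \<Rightarrow> ereal" where
  "zdot z (Fin w) = ereal (z \<bullet> w)"
| "zdot z CInf = \<infinity>"

fun phi :: "'a::euclidean_space set \<Rightarrow> 'a cext \<Rightarrow> ereal" where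
  "phi C (Fin w) = (SUP z \<in> {z \<in> dual_cone C. norm z = 1}. ereal (z \<bullet> w))"
| "phi C CInf = \<infinity>"


section \<open>Classes of functions\<close>

definition C_convex :: "'b::euclidean_space set \<Rightarrow> ('a::real_vector \<Rightarrow> 'b cext) \<Rightarrow> bool" where
  "C_convex C g \<longleftrightarrow> (\<forall>x y. \<forall>t\<in>{0<..1}.
     g (t *\<^sub>R x + (1 - t) *\<^sub>R y) \<preceq>\<^bsub>C\<^esub> t \<odot> g x \<oplus> (1 - t) \<odot> g y)"

definition C_proper :: "('a \<Rightarrow> 'b cext) \<Rightarrow> bool" where
  "C_proper g \<longleftrightarrow> (\<exists>x. g x \<noteq> CInf)"

definition lower_semicont :: "('a::topological_space \<Rightarrow> ereal) \<Rightarrow> bool" where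
  "lower_semicont F \<longleftrightarrow> (\<forall>x. F x \<le> Liminf (at x) F)"

definition C_closed ::
    "'b::euclidean_space set \<Rightarrow> ('a::topological_space \<Rightarrow> 'b cext) \<Rightarrow> bool" where
  "C_closed C g \<longleftrightarrow> (\<forall>z \<in> dual_cone C - {0}. lower_semicont (\<lambda>x. zdot z (g x)))"

definition continuously_differentiable :: "(real^'n \<Rightarrow> real^'m) \<Rightarrow> bool" where
  "continuously_differentiable f \<longleftrightarrow>
     (\<forall>x. f differentiable (at x)) \<and> continuous_on UNIV (\<lambda>x. jacobian f (at x))"

definition nabla :: "(real^'n \<Rightarrow> real^'m) \<Rightarrow> real^'n \<Rightarrow> real^'m^'n" where
  "nabla f x = transpose (jacobian f (at x))"

text \<open>The extended-sense membership of the directional derivative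
  \<open>D\<^sub>v h(y)\<close> in the negative interior of \<open>C\<close>, for finite \<open>h y\<close>.\<close>

definition dirderiv_neg_int ::
    "'b::euclidean_space set \<Rightarrow> ('a::real_vector \<Rightarrow> 'b cext) \<Rightarrow> 'a \<Rightarrow> 'a \<Rightarrow> bool" where
  "dirderiv_neg_int C h y v \<longleftrightarrow> (\<forall>z \<in> dual_cone C - {0}. \<exists>L<0.
     ((\<lambda>\<alpha>. ereal (1 / \<alpha>) * zdot z (h (y + \<alpha> *\<^sub>R v) \<ominus> h y)) \<longlongrightarrow> L) (at_right 0))"


section \<open>The set optimization problem\<close>

definition set_map :: "nat \<Rightarrow> (nat \<Rightarrow> 'a \<Rightarrow> 'b cext) \<Rightarrow> 'a \<Rightarrow> 'b cext set" where
  "set_map p h x = (\<lambda>j. h j x) ` {1..p}"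

definition set_dom ::
    "'b::euclidean_space set \<Rightarrow> nat \<Rightarrow> (nat \<Rightarrow> 'a \<Rightarrow> 'b cext) \<Rightarrow> 'a set" where
  "set_dom C p h = {x. \<forall>j\<in>{1..p}. h j x \<prec>\<^bsub>C\<^esub> CInf}"

definition minimal_set :: "'b::euclidean_space set \<Rightarrow> 'b cext set \<Rightarrow> 'b cext set" where
  "minimal_set C U = {u\<in>U. \<not> (\<exists>u'\<in>U. u' \<noteq> u \<and> u' \<preceq>\<^bsub>C\<^esub> u)}"

definition omega ::
    "'b::euclidean_space set \<Rightarrow> nat \<Rightarrow> (nat \<Rightarrow> 'a \<Rightarrow> 'b cext) \<Rightarrow> 'a \<Rightarrow> nat" where
  "omega C p h x = card (minimal_set C (set_map p h x))"

text \<open>A choice, for every \<open>x\<close>, of an enumeration \<open>u x 1, \<dots>, u x (\<omega>(x))\<close> of the minimal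
  elements of \<open>H(x)\<close>.\<close>

definition is_enumeration :: "'b::euclidean_space set \<Rightarrow> nat \<Rightarrow> (nat \<Rightarrow> 'a \<Rightarrow> 'b cext)
    \<Rightarrow> ('a \<Rightarrow> nat \<Rightarrow> 'b cext) \<Rightarrow> bool" where
  "is_enumeration C p h u \<longleftrightarrow>
     (\<forall>x. bij_betw (u x) {1..omega C p h x} (minimal_set C (set_map p h x)))"

definition active_indices ::
    "nat \<Rightarrow> (nat \<Rightarrow> 'a \<Rightarrow> 'b cext) \<Rightarrow> 'b cext \<Rightarrow> 'a \<Rightarrow> nat set" where
  "active_indices p h w x = {j\<in>{1..p}. h j x = w}"

definition partition_set :: "'b::euclidean_space set \<Rightarrow> nat \<Rightarrow> (nat \<Rightarrow> 'a \<Rightarrow> 'b cext)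
    \<Rightarrow> ('a \<Rightarrow> nat \<Rightarrow> 'b cext) \<Rightarrow> 'a \<Rightarrow> (nat \<Rightarrow> nat) set" where
  "partition_set C p h u x =
     (\<Pi>\<^sub>E j\<in>{1..omega C p h x}. active_indices p h (u x j) x)"

definition stationary :: "'b::euclidean_space set \<Rightarrow> nat \<Rightarrow> (nat \<Rightarrow> 'a::real_vector \<Rightarrow> 'b cext)
    \<Rightarrow> ('a \<Rightarrow> nat \<Rightarrow> 'b cext) \<Rightarrow> 'a \<Rightarrow> bool" where
  "stationary C p h u y \<longleftrightarrow> (\<forall>a \<in> partition_set C p h u y. \<forall>v.
     \<exists>j\<in>{1..omega C p h y}. \<not> dirderiv_neg_int C (h (a j)) y v)"

definition model :: "(real^'n \<Rightarrow> real^'m) \<Rightarrow> (real^'n \<Rightarrow> (real^'m) cext)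
    \<Rightarrow> real^'n \<Rightarrow> real^'n \<Rightarrow> (real^'m) cext" where
  "model f g y v = Fin (transpose (nabla f y) *v v) \<oplus> g (y + v) \<ominus> g y"

text \<open>The objective of the proximal gradient subproblem; \<open>k\<close> is the length \<open>\<omega>(y)\<close> of \<open>a\<close>.\<close>

definition objective :: "(real^'m) set \<Rightarrow> (nat \<Rightarrow> real^'n \<Rightarrow> real^'m)
    \<Rightarrow> (nat \<Rightarrow> real^'n \<Rightarrow> (real^'m) cext) \<Rightarrow> real \<Rightarrow> nat \<Rightarrow> real^'n
    \<Rightarrow> (nat \<Rightarrow> nat) \<times> (real^'n) \<Rightarrow> ereal" where
  "objective C f g l k y = (\<lambda>(a, v).
     (MAX j\<in>{1..k}. phi C (model (f (a j)) (g (a j)) y v)) + ereal (l / 2 * (norm v)\<^sup>2))"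

end

theory Submission
  imports Defs
begin

text \<open>
  Convexity makes the quotients \<open>z\<^sup>T (g (y + t v') - g y) / t\<close> nondecreasing in \<open>t\<close>, so for a
  descent direction \<open>v'\<close> at a non-stationary \<open>y\<close> the linearised quotient is negative for each
  \<open>z\<close> of the dual unit sphere from some \<open>t\<close> on downwards, and by compactness from a common \<open>t\<close>.
  Hence \<open>\<phi>\<close> of the model at \<open>t v'\<close> is at most \<open>- \<delta> t\<close>, which beats the quadratic term for small
  \<open>t\<close>: the optimal value is negative, and all model vectors at the minimiser lie in the negative
  interior of the cone. The error of linearising \<open>f\<close> is of order \<open>o(\<alpha>)\<close> and therefore absorbed by the slack
  \<open>(1 - \<rho>) \<alpha>\<close>, which gives (i) for all small \<open>\<alpha>\<close>; (ii) follows because every element of the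
  finite set \<open>H(y)\<close> dominates a minimal one.
\<close>

section \<open>Ordering cones: separation, interior, dual sphere\<close>

text \<open>A point outside the interior is separated from it by a hyperplane. Since
  \<open>C\<close> is the closure of its interior, the bound extends to all of \<open>C\<close>.
  Scaling inside the cone then forces the normal vector into the dual cone, and \<open>0\<close> in
  \<open>C\<close> forces it to be nonpositive at \<open>x\<close>, contradicting
  \<open>pos\<close>.\<close>

lemma interior_cone_if_dual_pos:
  fixes C :: "'a::euclidean_space set"
  assumes C: "ordering_cone C" and pos: "\<And>z. z \<in> dual_cone C - {0} \<Longrightarrow> 0 < z \<bullet> x"
  shows "x \<in> interior C"
proof (rule ccontr)
  assume x: "x \<notin> interior C"
  have cl: "closed C" and cv: "convex C" and co: "cone C" and ne: "interior C \<noteq> {}"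
    using C by (auto simp: ordering_cone_def)
  obtain z b where z: "z \<noteq> 0" and lo: "\<And>c. c \<in> {x} \<Longrightarrow> z \<bullet> c \<le> b"
      and hi: "\<And>c. c \<in> interior C \<Longrightarrow> b \<le> z \<bullet> c"
    using separating_hyperplane_sets[of "{x}" "interior C"] x ne cv
    by (auto simp: convex_interior)
  have "closure (interior C) \<subseteq> {c. b \<le> z \<bullet> c}"
    by (rule closure_minimal) (use hi in \<open>auto simp: closed_halfspace_ge\<close>)
  then have hiC: "b \<le> z \<bullet> c" if "c \<in> C" for c
    using that convex_closure_interior[OF cv ne] cl by auto
  have zdual: "0 \<le> z \<bullet> c" if "c \<in> C" for c
  proof (rule ccontr)
    assume neg: "\<not> 0 \<le> z \<bullet> c"
    \<comment> \<open>The factor makes \<open>z\<close> take the value \<open>- |b| - 1\<close>,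
      which is below \<open>b\<close>, at the scaled point, so the halfspace bound fails
      there.\<close>
    define t where "t = (\<bar>b\<bar> + 1) / - (z \<bullet> c)"
    have t: "0 \<le> t" "t * (z \<bullet> c) = - \<bar>b\<bar> - 1" using neg by (auto simp: t_def field_simps)
    have "t *\<^sub>R c \<in> C" using co that t(1) by (auto simp: cone_def)
    from hiC[OF this] t(2) show False by auto
  qed
  have "0 \<in> C" using cone_contains_0[OF co] ne interior_subset by blast
  then have "z \<bullet> x \<le> 0" using hiC lo by force
  moreover have "z \<in> dual_cone C" using zdual by (auto simp: dual_cone_def inner_commute)
  ultimately show False using pos[of z] z by force
qed

lemma ordering_cone_add:
  assumes "ordering_cone C" "x \<in> C" "w \<in> C"
  shows "x + w \<in> C"
  using assms convex_cone[of C] unfolding ordering_cone_def by blast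

lemma ordering_cone_scale:
  assumes "ordering_cone C" "x \<in> C" "0 \<le> t"
  shows "t *\<^sub>R x \<in> C"
  using assms unfolding ordering_cone_def cone_def by blast

lemma interior_cone_add:
  assumes C: "ordering_cone C" and x: "x \<in> interior C" and w: "w \<in> C"
  shows "x + w \<in> interior C"
proof -
  have "open ((\<lambda>c. c + w) ` interior C)"
    using open_translation[of "interior C" w] by (simp add: add.commute)
  moreover have "(\<lambda>c. c + w) ` interior C \<subseteq> C"
    using ordering_cone_add[OF C _ w] interior_subset by blast
  ultimately have "(\<lambda>c. c + w) ` interior C \<subseteq> interior C" by (rule interior_maximal[rotated])
  with x show ?thesis by blast
qed

lemma interior_cone_scale:
  assumes C: "ordering_cone C" and x: "x \<in> interior C" and t: "0 < t"
  shows "t *\<^sub>R x \<in> interior C"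
proof -
  have "open ((*\<^sub>R) t ` interior C)" using t by (intro open_scaling) auto
  moreover have "(*\<^sub>R) t ` interior C \<subseteq> C"
    using ordering_cone_scale[OF C] t interior_subset by fastforce
  ultimately have "(*\<^sub>R) t ` interior C \<subseteq> interior C" by (rule interior_maximal[rotated])
  with x show ?thesis by blast
qed

text \<open>Pointedness excludes \<open>0\<close> from the interior. If the dual cone were trivial,
  the positivity criterion for interior points would hold vacuously at \<open>0\<close>.
  Nonemptiness is what later lets a continuous function attain its maximum on the dual
  sphere.\<close>

lemma dual_sphere_nonempty:
  fixes C :: "'a::euclidean_space set"
  assumes C: "ordering_cone C"
  shows "{z \<in> dual_cone C. norm z = 1} \<noteq> {}"
proof -
  have "0 \<notin> interior C"
  proof
    assume "0 \<in> interior C"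
    then obtain e where e: "0 < e" "cball 0 e \<subseteq> C" by (auto simp: mem_interior_cball)
    obtain b :: 'a where b: "b \<in> Basis" using nonempty_Basis by blast
    have "e *\<^sub>R b \<in> C" "- (e *\<^sub>R b) \<in> C" using e b by (auto intro!: subsetD[OF e(2)])
    then have "e *\<^sub>R b \<in> C \<inter> uminus ` C" by (metis IntI image_eqI minus_minus)
    with C e(1) b show False by (auto simp: ordering_cone_def)
  qed
  then obtain z where z: "z \<in> dual_cone C" "z \<noteq> 0"
    using interior_cone_if_dual_pos[OF C, of 0] by force
  then have "z /\<^sub>R norm z \<in> {z \<in> dual_cone C. norm z = 1}"
    by (auto simp: dual_cone_def)
  then show ?thesis by blast
qed

lemma compact_dual_sphere:
  fixes C :: "'a::euclidean_space set"
  shows "compact {z \<in> dual_cone C. norm z = 1}"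
proof -
  have "dual_cone C = (\<Inter>w\<in>C. {z. w \<bullet> z \<ge> 0})" by (auto simp: dual_cone_def)
  then have "closed (dual_cone C)" by (auto intro!: closed_INT closed_halfspace_ge)
  moreover have "{z \<in> dual_cone C. norm z = 1} = sphere 0 1 \<inter> dual_cone C" by auto
  ultimately show ?thesis by (simp add: compact_Int_closed)
qed

section \<open>The order on extended vectors and domination by minimal elements\<close>

lemma cle_trans:
  assumes "ordering_cone C" "x \<preceq>\<^bsub>C\<^esub> w" "w \<preceq>\<^bsub>C\<^esub> s"
  shows "x \<preceq>\<^bsub>C\<^esub> s"
proof (cases x; cases w; cases s)
  fix a b c assume eq: "x = Fin a" "w = Fin b" "s = Fin c"
  then have "(c - b) + (b - a) \<in> C" using assms by (intro ordering_cone_add) auto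
  then show ?thesis using eq by simp
qed (use assms(2,3) in auto)

lemma cless_cle_trans:
  assumes "ordering_cone C" "x \<prec>\<^bsub>C\<^esub> w" "w \<preceq>\<^bsub>C\<^esub> s"
  shows "x \<prec>\<^bsub>C\<^esub> s"
proof (cases x; cases w; cases s)
  fix a b c assume eq: "x = Fin a" "w = Fin b" "s = Fin c"
  then have "(b - a) + (c - b) \<in> interior C" using assms by (intro interior_cone_add) auto
  then show ?thesis using eq by simp
qed (use assms(2,3) in auto)

lemma cle_cless_trans:
  assumes "ordering_cone C" "x \<preceq>\<^bsub>C\<^esub> w" "w \<prec>\<^bsub>C\<^esub> s"
  shows "x \<prec>\<^bsub>C\<^esub> s"
proof (cases x; cases w; cases s)
  fix a b c assume eq: "x = Fin a" "w = Fin b" "s = Fin c"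
  then have "(c - b) + (b - a) \<in> interior C" using assms by (intro interior_cone_add) auto
  then show ?thesis using eq by simp
qed (use assms(2,3) in auto)

lemma cle_antisym:
  assumes "ordering_cone C" "x \<preceq>\<^bsub>C\<^esub> w" "w \<preceq>\<^bsub>C\<^esub> x"
  shows "x = w"
proof (cases x; cases w)
  fix a b assume eq: "x = Fin a" "w = Fin b"
  then have "b - a \<in> C" "a - b \<in> C" using assms by auto
  then have "b - a \<in> C \<inter> uminus ` C" by (metis IntI image_eqI minus_diff_eq)
  then have "b - a = 0" using assms(1) unfolding ordering_cone_def by blast
  then show ?thesis using eq by simp
qed (use assms(2,3) in auto)

lemma cle_refl:
  assumes "ordering_cone C" shows "x \<preceq>\<^bsub>C\<^esub> x"
proof -
  have "0 \<in> C" using assms unfolding ordering_cone_def by blast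
  then show ?thesis by (cases x) simp_all
qed

text \<open>Take a minimal element, for the strict part of the order, among the finitely many
  elements below \<open>x\<close>. It stays minimal in all of \<open>U\<close>, because anything
  below it is again below \<open>x\<close>.\<close>

lemma finite_domination:
  assumes C: "ordering_cone C" and fin: "finite U" and x: "x \<in> U"
  shows "\<exists>m\<in>minimal_set C U. m \<preceq>\<^bsub>C\<^esub> x"
proof -
  define R where "R = (\<lambda>b c. b \<preceq>\<^bsub>C\<^esub> c \<and> b \<noteq> c)"
  define A where "A = {b \<in> U. b \<preceq>\<^bsub>C\<^esub> x}"
  have "x \<in> A" using x cle_refl[OF C] by (simp add: A_def)
  moreover have "asymp_on A R" using cle_antisym[OF C] by (auto simp: R_def asymp_on_def)
  moreover have "transp_on A R"
    unfolding transp_on_def R_def using cle_trans[OF C] cle_antisym[OF C] by blast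
  ultimately obtain m where m: "m \<in> A" "\<forall>b\<in>A. \<not> R b m"
    using Finite_Set.bex_min_element[of A R] fin by (fastforce simp: A_def R_def)
  then have "m \<in> minimal_set C U"
    using cle_trans[OF C] unfolding minimal_set_def A_def R_def by blast
  with m show ?thesis by (auto simp: A_def)
qed

section \<open>One-sided quotients and the sufficient decrease estimate\<close>

lemma directional_quotient_tendsto:
  fixes f :: "'a::real_normed_vector \<Rightarrow> 'b::real_normed_vector"
  assumes "(f has_derivative f') (at y)"
  shows "((\<lambda>t. (f (y + t *\<^sub>R v) - f y) /\<^sub>R t) \<longlongrightarrow> f' v) (at_right 0)"
proof -
  interpret bounded_linear f' using assms by (rule has_derivative_bounded_linear)
  have "((\<lambda>t. f (y + t *\<^sub>R v)) has_derivative (\<lambda>t. f' (t *\<^sub>R v))) (at 0 within {0<..})"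
    by (rule has_derivative_compose[of "\<lambda>t. y + t *\<^sub>R v" "\<lambda>t. t *\<^sub>R v" 0 _ f f'])
       (auto intro!: derivative_eq_intros assms)
  then have "((\<lambda>t. f (y + t *\<^sub>R v)) has_vector_derivative f' v) (at 0 within {0<..})"
    by (simp add: has_vector_derivative_def scaleR)
  then have "((\<lambda>t. (f (y + t *\<^sub>R v) - f y - t *\<^sub>R f' v) /\<^sub>R norm t) \<longlongrightarrow> 0) (at_right 0)"
    by (auto simp: has_vector_derivative_def has_derivative_at_within)
  \<comment> \<open>For positive \<open>t\<close> the norm of \<open>t\<close> is \<open>t\<close>
    itself, so the normalised remainder is exactly the quotient minus its limit.\<close>
  then have "((\<lambda>t. (f (y + t *\<^sub>R v) - f y) /\<^sub>R t - f' v) \<longlongrightarrow> 0) (at_right 0)"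
    by (rule Lim_transform_eventually)
       (auto simp: eventually_at_filter scaleR_diff_right intro!: always_eventually)
  then show ?thesis by (simp add: LIM_zero_iff)
qed

text \<open>This is the chord inequality in difference form. Finiteness at both endpoints passes to
  the segment because \<open>CInf\<close> is not below any finite vector.\<close>

lemma C_convex_segment:
  assumes g: "C_convex C g" and y: "g y = Fin b" and yv: "g (y + v) = Fin c"
    and s: "0 < s" "s \<le> 1"
  obtains e where "g (y + s *\<^sub>R v) = Fin e" "s *\<^sub>R (c - b) - (e - b) \<in> C"
proof -
  have "s *\<^sub>R (y + v) + (1 - s) *\<^sub>R y = y + s *\<^sub>R v" by (simp add: algebra_simps)
  then have le: "g (y + s *\<^sub>R v) \<preceq>\<^bsub>C\<^esub> s \<odot> Fin c \<oplus> (1 - s) \<odot> Fin b"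
    using g s y yv unfolding C_convex_def by (metis greaterThanAtMost_iff)
  then obtain e where e: "g (y + s *\<^sub>R v) = Fin e" by (cases "g (y + s *\<^sub>R v)") auto
  with le have "s *\<^sub>R (c - b) - (e - b) \<in> C" by (simp add: algebra_simps)
  with e show thesis by (rule that)
qed

text \<open>The gap between the two sides, divided by \<open>\<alpha>\<close>, is the slack
  \<open>(1 - \<rho>)\<close> times the negated model vector, plus the linearisation error of
  \<open>f\<close>, plus a convexity gap in \<open>C\<close>. The first two together tend to an
  interior point of \<open>C\<close>, hence eventually lie in the interior.\<close>

lemma eventually_sufficient_decrease:
  fixes f :: "'a::real_normed_vector \<Rightarrow> 'b::euclidean_space"
  assumes C: "ordering_cone C" and f: "(f has_derivative f') (at y)" and g: "C_convex C g"
    and y: "g y = Fin b" and yv: "g (y + v) = Fin c"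
    and d: "- (f' v + c - b) \<in> interior C" and \<rho>: "\<rho> < 1"
  shows "\<forall>\<^sub>F \<alpha> in at_right 0.
    Fin (f (y + \<alpha> *\<^sub>R v)) \<oplus> g (y + \<alpha> *\<^sub>R v) \<preceq>\<^bsub>C\<^esub> Fin (f y + b + (\<rho> * \<alpha>) *\<^sub>R (f' v + c - b))"
proof -
  let ?r = "\<lambda>\<alpha>. (f (y + \<alpha> *\<^sub>R v) - f y) /\<^sub>R \<alpha>"
  let ?d = "f' v + c - b"
  have "((\<lambda>\<alpha>. (1 - \<rho>) *\<^sub>R (- ?d) + (f' v - ?r \<alpha>)) \<longlongrightarrow> (1 - \<rho>) *\<^sub>R (- ?d) + (f' v - f' v)) (at_right 0)"
    by (intro tendsto_intros directional_quotient_tendsto f)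
  moreover have "(1 - \<rho>) *\<^sub>R (- ?d) + (f' v - f' v) \<in> interior C"
    using interior_cone_scale[OF C d, of "1 - \<rho>"] \<rho> by simp
  ultimately have "\<forall>\<^sub>F \<alpha> in at_right 0. (1 - \<rho>) *\<^sub>R (- ?d) + (f' v - ?r \<alpha>) \<in> interior C"
    using topological_tendstoD open_interior by blast
  moreover have "\<forall>\<^sub>F \<alpha> in at_right (0::real). \<alpha> \<in> {0<..<1}"
    by (rule eventually_at_right_real) simp
  ultimately show ?thesis
  proof eventually_elim
    case (elim \<alpha>)
    then have \<alpha>: "0 < \<alpha>" "\<alpha> \<le> 1" by auto
    obtain e where e: "g (y + \<alpha> *\<^sub>R v) = Fin e" "\<alpha> *\<^sub>R (c - b) - (e - b) \<in> C"
      using C_convex_segment[OF g y yv \<alpha>] .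
    \<comment> \<open>The sum of the scaled interior vector and the convexity gap of
      \<open>g\<close> is rearranged below into the difference of the two sides of the
      claim.\<close>
    have "\<alpha> *\<^sub>R ((1 - \<rho>) *\<^sub>R (- ?d) + (f' v - ?r \<alpha>)) + (\<alpha> *\<^sub>R (c - b) - (e - b)) \<in> C"
      by (rule ordering_cone_add[OF C ordering_cone_scale[OF C] e(2)])
         (use elim(1) \<alpha> interior_subset in auto)
    also have "\<alpha> *\<^sub>R ((1 - \<rho>) *\<^sub>R (- ?d) + (f' v - ?r \<alpha>)) + (\<alpha> *\<^sub>R (c - b) - (e - b))
       = f y + b + (\<rho> * \<alpha>) *\<^sub>R ?d - (f (y + \<alpha> *\<^sub>R v) + e)"
      using \<alpha> by (simp add: algebra_simps)
    finally show ?case using e(1) by simp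
  qed
qed

section \<open>Negativity of the scalarized model\<close>

lemma interior_cone_if_phi_neg:
  fixes C :: "'a::euclidean_space set"
  assumes C: "ordering_cone C" and neg: "phi C (Fin w) < 0"
  shows "- w \<in> interior C"
proof (rule interior_cone_if_dual_pos[OF C])
  fix z assume z: "z \<in> dual_cone C - {0}"
  then have "z /\<^sub>R norm z \<in> {z \<in> dual_cone C. norm z = 1}" by (auto simp: dual_cone_def)
  then have "ereal ((z /\<^sub>R norm z) \<bullet> w) \<le> phi C (Fin w)"
    unfolding phi.simps by (rule SUP_upper)
  also note neg
  finally have "ereal ((z /\<^sub>R norm z) \<bullet> w) < 0" .
  with z show "0 < z \<bullet> (- w)" by (simp add: field_simps)
qed


text \<open>The constant \<open>K\<close> may be arbitrary because the scalarized model is bounded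
  by a negative multiple of \<open>t\<close>, which beats any multiple of the square of
  \<open>t\<close> near zero. The application takes for \<open>K\<close> the coefficient of the
  proximal term.\<close>

lemma eventually_phi_less:
  fixes f :: "'a::real_normed_vector \<Rightarrow> 'b::euclidean_space"
  assumes C: "ordering_cone C" and f: "(f has_derivative f') (at y)" and g: "C_convex C g"
    and y: "g y = Fin b"
    and dn: "dirderiv_neg_int C (\<lambda>x. Fin (f x) \<oplus> g x) y v"
  shows "\<forall>\<^sub>F t in at_right 0.
    phi C (Fin (f' (t *\<^sub>R v)) \<oplus> g (y + t *\<^sub>R v) \<ominus> g y) < ereal (- K * t\<^sup>2)"
proof -
  define Z where "Z = {z \<in> dual_cone C. norm z = 1}"
  \<comment> \<open>\<open>W t\<close> is the model vector at \<open>t *\<^sub>R v\<close> divided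
    by \<open>t\<close>. Its value is meaningful only where \<open>g\<close> is finite, which is why
    \<open>T\<close> is introduced.\<close>
  define W where "W t = f' v + ((case g (y + t *\<^sub>R v) of Fin c \<Rightarrow> c) - b) /\<^sub>R t" for t
  define T where "T = {t \<in> {0<..<1}. g (y + t *\<^sub>R v) \<noteq> CInf}"
  have mono: "s \<in> T \<and> z \<bullet> W s \<le> z \<bullet> W t" if t: "t \<in> T" and s: "0 < s" "s \<le> t"
    and z: "z \<in> Z" for s t z
  proof -
    obtain c where c: "g (y + t *\<^sub>R v) = Fin c" using t by (cases "g (y + t *\<^sub>R v)") (auto simp: T_def)
    obtain e where "g (y + (s / t) *\<^sub>R t *\<^sub>R v) = Fin e"
        and e2: "(s / t) *\<^sub>R (c - b) - (e - b) \<in> C"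
      by (rule C_convex_segment[OF g y c, of "s / t"]) (use s in auto)
    then have e: "g (y + s *\<^sub>R v) = Fin e" using s by simp
    have "0 \<le> ((s / t) *\<^sub>R (c - b) - (e - b)) \<bullet> z" using z e2 by (auto simp: Z_def dual_cone_def)
    then have "z \<bullet> (e - b) \<le> (s / t) * (z \<bullet> (c - b))"
      by (subst (asm) inner_commute) (simp add: inner_diff_right right_diff_distrib)
    then have "(z \<bullet> (e - b)) / s \<le> (z \<bullet> (c - b)) / t" using s by (simp add: field_simps)
    then show ?thesis using e c s t by (simp add: W_def T_def inner_add_right divide_inverse mult.commute)
  qed
  have "\<exists>t\<in>T. z \<bullet> W t < 0" if z: "z \<in> Z" for z
  proof -
    let ?q = "\<lambda>t. (f (y + t *\<^sub>R v) - f y) /\<^sub>R t"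
    have "z \<in> dual_cone C - {0}" using z by (auto simp: Z_def)
    then obtain L where L: "L < 0" and lim: "((\<lambda>t. ereal (1 / t) * zdot z
         (Fin (f (y + t *\<^sub>R v)) \<oplus> g (y + t *\<^sub>R v) \<ominus> (Fin (f y) \<oplus> g y))) \<longlongrightarrow> L) (at_right 0)"
      using dn unfolding dirderiv_neg_int_def by blast
    \<comment> \<open>A real \<open>c\<close> handles \<open>L\<close> possibly being minus infinity
      and is used twice: the quotient of the full function drops below \<open>c\<close>, while that
      of \<open>f\<close> stays above its limit plus \<open>c\<close>. Subtracting leaves a negative
      value.\<close>
    obtain c where c: "L < ereal c" "ereal c < 0" using ereal_dense2[OF L] by blast
    have "((\<lambda>t. z \<bullet> ?q t) \<longlongrightarrow> z \<bullet> f' v) (at_right 0)"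
      by (intro tendsto_intros directional_quotient_tendsto f)
    then have "\<forall>\<^sub>F t in at_right 0. z \<bullet> f' v + c < z \<bullet> ?q t"
      by (rule order_tendstoD) (use c in simp)
    moreover have "\<forall>\<^sub>F t in at_right (0::real). t \<in> {0<..<1}"
      by (rule eventually_at_right_real) simp
    ultimately have "\<forall>\<^sub>F t in at_right 0. t \<in> T \<and> z \<bullet> W t < 0"
      using order_tendstoD(2)[OF lim c(1)]
    proof eventually_elim
      case (elim t)
      \<comment> \<open>If \<open>g\<close> were \<open>CInf\<close> here, the scalarized quotient
        would be infinite and could not lie below \<open>c\<close>.\<close>
      then obtain e where e: "g (y + t *\<^sub>R v) = Fin e"
        by (cases "g (y + t *\<^sub>R v)") auto
      have "z \<bullet> W t = z \<bullet> f' v + (1 / t * (z \<bullet> (f (y + t *\<^sub>R v) + e - (f y + b))) - z \<bullet> ?q t)"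
        using elim(2) by (simp add: W_def e inner_simps divide_simps)
      also have "\<dots> < 0" using elim e y c(2) by simp
      finally show ?case using e elim(2) by (simp add: T_def)
    qed
    then show ?thesis using eventually_happens trivial_limit_at_right_real by blast
  qed
  then have cover: "Z \<subseteq> (\<Union>t\<in>T. {z. z \<bullet> W t < 0})" by blast
  have Z: "compact Z" "Z \<noteq> {}"
    using compact_dual_sphere dual_sphere_nonempty[OF C] by (simp_all add: Z_def)
  obtain T' where T': "T' \<subseteq> T" "finite T'" "Z \<subseteq> (\<Union>t\<in>T'. {z. z \<bullet> W t < 0})"
  proof (rule compactE_image[OF Z(1) _ cover])
    show "open {z. z \<bullet> W t < 0}" for t
      using open_halfspace_lt[of "W t" 0] by (simp add: inner_commute)
  qed
  have "T' \<noteq> {}" using T'(3) Z(2) by auto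
  \<comment> \<open>By monotonicity the halfspaces grow as \<open>t\<close> decreases, so the
    smallest parameter of the finite subcover serves every \<open>z\<close> at once.\<close>
  define t0 where "t0 = Min T'"
  have t0: "t0 \<in> T" using T'(1) Min_in[OF T'(2) \<open>T' \<noteq> {}\<close>] by (auto simp: t0_def)
  then have "0 < t0" by (simp add: T_def)
  have neg: "z \<bullet> W t0 < 0" if z: "z \<in> Z" for z
  proof -
    obtain t where t: "t \<in> T'" "z \<bullet> W t < 0" using T'(3) z by blast
    then have "t0 \<le> t" using T'(2) by (simp add: t0_def)
    then show ?thesis using mono[of t t0 z] t T'(1) \<open>0 < t0\<close> z by force
  qed
  obtain z0 where z0: "z0 \<in> Z" "\<And>z. z \<in> Z \<Longrightarrow> z \<bullet> W t0 \<le> z0 \<bullet> W t0"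
  proof -
    have "continuous_on Z (\<lambda>z. z \<bullet> W t0)" by (intro continuous_intros)
    then show thesis using continuous_attains_sup[OF Z] that by blast
  qed
  \<comment> \<open>Since the maximum over the compact dual sphere is attained, pointwise negativity
    becomes a uniform margin.\<close>
  define \<delta> where "\<delta> = - (z0 \<bullet> W t0)"
  have \<delta>: "0 < \<delta>" using neg z0(1) by (simp add: \<delta>_def)
  \<comment> \<open>The second bound gives \<open>K * t < \<delta>\<close> for either sign of
    \<open>K\<close>; adding 1 keeps the denominator positive.\<close>
  have "\<forall>\<^sub>F t in at_right 0. t \<in> {0<..<min t0 (\<delta> / (\<bar>K\<bar> + 1))}"
    by (rule eventually_at_right_real) (use \<delta> \<open>0 < t0\<close> in simp)
  then show ?thesis
  proof eventually_elim
    case (elim t)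
    then have t: "0 < t" "t \<le> t0" "t < \<delta> / (\<bar>K\<bar> + 1)" by auto
    interpret f': bounded_linear f' using f by (rule has_derivative_bounded_linear)
    have tT: "t \<in> T" using mono[OF t0 t(1,2) z0(1)] by simp
    then obtain e where e: "g (y + t *\<^sub>R v) = Fin e"
      by (cases "g (y + t *\<^sub>R v)") (auto simp: T_def)
    have eq: "Fin (f' (t *\<^sub>R v)) \<oplus> g (y + t *\<^sub>R v) \<ominus> g y = Fin (t *\<^sub>R W t)"
      using t by (simp add: e y W_def f'.scaleR scaleR_add_right)
    have "z \<bullet> (t *\<^sub>R W t) \<le> - \<delta> * t" if "z \<in> Z" for z
    proof -
      have "z \<bullet> W t \<le> - \<delta>"
        using mono[OF t0 t(1,2) that] z0(2)[OF that] by (simp add: \<delta>_def)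
      from mult_left_mono[OF this, of t] show ?thesis using t by (simp add: mult.commute)
    qed
    then have "phi C (Fin (t *\<^sub>R W t)) \<le> ereal (- \<delta> * t)"
      by (auto simp: Z_def intro!: SUP_least)
    also have "\<dots> < ereal (- K * t\<^sup>2)"
    proof -
      have "K * t \<le> (\<bar>K\<bar> + 1) * t" using t by (intro mult_right_mono) auto
      also have "\<dots> < \<delta>" using t(3) by (simp add: field_simps)
      finally have "K * t * t < \<delta> * t" using t(1) by (rule mult_strict_right_mono)
      then show ?thesis by (simp add: power2_eq_square mult.assoc)
    qed
    finally show ?case unfolding eq .
  qed
qed

section \<open>Negative optimal value, decrease along the minimising direction, and the interval of
  step sizes\<close>

theorem theorem4p1:
  fixes C :: "(real^'m) set"
    and p :: nat
    and f :: "nat \<Rightarrow> real^'n \<Rightarrow> real^'m"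
    and g h :: "nat \<Rightarrow> real^'n \<Rightarrow> (real^'m) cext"
    and u :: "real^'n \<Rightarrow> nat \<Rightarrow> (real^'m) cext"
    and l \<rho> :: real
    and y v :: "real^'n"
    and a :: "nat \<Rightarrow> nat"
  assumes "ordering_cone C"
    and "1 \<le> p"
    and "\<And>j. j \<in> {1..p} \<Longrightarrow> continuously_differentiable (f j)"
    and "\<And>j. j \<in> {1..p} \<Longrightarrow> C_proper (g j) \<and> C_closed C (g j) \<and> C_convex C (g j)"
    and "\<And>j x. j \<in> {1..p} \<Longrightarrow> h j x = Fin (f j x) \<oplus> g j x"
    and "is_enumeration C p h u"
    and "0 < l"
    and "0 < \<rho>" and "\<rho> < 1"
    and "y \<in> set_dom C p h"
    and "\<not> stationary C p h u y"
    and "is_arg_min (objective C f g l (omega C p h y) y)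
           (\<lambda>av. av \<in> partition_set C p h u y \<times> UNIV) (a, v)"
  shows "\<exists>I \<subseteq> {0<..1::real}. is_interval I \<and> (\<exists>s\<in>I. \<exists>t\<in>I. s \<noteq> t) \<and>
    (\<forall>\<alpha>\<in>I.
      (\<forall>j\<in>{1..omega C p h y}.
         h (a j) (y + \<alpha> *\<^sub>R v) \<preceq>\<^bsub>C\<^esub>
           h (a j) y \<oplus> (\<rho> * \<alpha>) \<odot> model (f (a j)) (g (a j)) y v) \<and>
      set_map p h (y + \<alpha> *\<^sub>R v) \<prec>\<^sup>l\<^bsub>C\<^esub> set_map p h y)"
proof -
  note C = assms(1) and cvx = assms(4)[THEN conjunct2, THEN conjunct2] and h = assms(5)
  define k where "k = omega C p h y"
  define J where "J j = jacobian (f j) (at y)" for j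
  have J: "(f j has_derivative (\<lambda>w. J j *v w)) (at y)" if "j \<in> {1..p}" for j
    using assms(3)[OF that] jacobian_works by (auto simp: continuously_differentiable_def J_def)
  have model: "model (f j) (g j) y w = Fin (J j *v w) \<oplus> g j (y + w) \<ominus> g j y" for j w
    by (simp add: model_def nabla_def J_def)
  have "\<exists>b. g j y = Fin b" if "j \<in> {1..p}" for j
  proof -
    have "h j y \<prec>\<^bsub>C\<^esub> CInf" using assms(10) that unfolding set_dom_def by blast
    then show ?thesis using h[OF that, of y] by (cases "g j y") auto
  qed
  then obtain b where b: "\<And>j. j \<in> {1..p} \<Longrightarrow> g j y = Fin (b j)" by metis
  have fin: "finite (set_map p h y)" by (simp add: set_map_def)
  have u: "bij_betw (u y) {1..k} (minimal_set C (set_map p h y))"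
    using assms(6) by (simp add: is_enumeration_def k_def)
  have "h 1 y \<in> set_map p h y" using assms(2) by (auto simp: set_map_def)
  then have "minimal_set C (set_map p h y) \<noteq> {}" using finite_domination[OF C fin] by blast
  \<comment> \<open>The comparisons of \<open>MAX\<close> with a bound below are valid only over a
    nonempty index set.\<close>
  then have k: "{1..k} \<noteq> {}" using u by (auto simp: bij_betw_def)
  have part: "a' j \<in> {1..p} \<and> h (a' j) y = u y j"
    if "a' \<in> partition_set C p h u y" "j \<in> {1..k}" for a' j
    using PiE_mem[OF that(1)[unfolded partition_set_def], of j] that(2)
    by (simp add: k_def active_indices_def)
  obtain a' v' where a': "a' \<in> partition_set C p h u y"
    and dn: "\<And>j. j \<in> {1..k} \<Longrightarrow> dirderiv_neg_int C (h (a' j)) y v'"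
    using assms(11) unfolding stationary_def k_def by blast
  \<comment> \<open>At \<open>t *\<^sub>R v'\<close> the proximal term equals \<open>?K\<close>
    times the square of \<open>t\<close>, so the estimate with this constant makes the objective
    negative.\<close>
  let ?K = "l / 2 * (norm v')\<^sup>2"
  have "\<forall>\<^sub>F t in at_right 0. phi C (model (f (a' j)) (g (a' j)) y (t *\<^sub>R v')) < ereal (- ?K * t\<^sup>2)"
    if j: "j \<in> {1..k}" for j
  proof -
    have ap: "a' j \<in> {1..p}" using part[OF a' j] by simp
    then have "h (a' j) = (\<lambda>x. Fin (f (a' j) x) \<oplus> g (a' j) x)" using h by auto
    then show ?thesis
      using eventually_phi_less[OF C J[OF ap] cvx[OF ap] b[OF ap], of v' ?K] dn[OF j]
      by (simp add: model)
  qed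
  then have "\<forall>\<^sub>F t in at_right 0. \<forall>j\<in>{1..k}.
      phi C (model (f (a' j)) (g (a' j)) y (t *\<^sub>R v')) < ereal (- ?K * t\<^sup>2)"
    by (intro eventually_ball_finite) auto
  then obtain t where t: "\<And>j. j \<in> {1..k} \<Longrightarrow>
      phi C (model (f (a' j)) (g (a' j)) y (t *\<^sub>R v')) < ereal (- ?K * t\<^sup>2)"
    using eventually_happens trivial_limit_at_right_real by blast
  let ?obj = "objective C f g l k y"
  have "?obj (a', t *\<^sub>R v') < 0"
  proof -
    let ?M = "MAX j\<in>{1..k}. phi C (model (f (a' j)) (g (a' j)) y (t *\<^sub>R v'))"
    have "?M < ereal (- ?K * t\<^sup>2)" using k t by (subst Max_less_iff) auto
    moreover have "?obj (a', t *\<^sub>R v') = ?M + ereal (?K * t\<^sup>2)"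
      by (simp add: objective_def power_mult_distrib mult_ac)
    ultimately show ?thesis by (cases ?M) auto
  qed
  moreover have "?obj (a, v) \<le> ?obj (a', t *\<^sub>R v')" and a: "a \<in> partition_set C p h u y"
    using assms(12) a' by (auto simp: is_arg_min_def k_def not_less)
  ultimately have obj: "?obj (a, v) < 0" by simp
  \<comment> \<open>Dropping the nonnegative proximal term transfers negativity from the optimal
    value to each scalarized model.\<close>
  have "(MAX j\<in>{1..k}. phi C (model (f (a j)) (g (a j)) y v)) \<le> ?obj (a, v)"
    unfolding objective_def case_prod_conv using assms(7)
    by (intro ereal_le_add_self) auto
  then have "(MAX j\<in>{1..k}. phi C (model (f (a j)) (g (a j)) y v)) < 0"
    using obj by (rule le_less_trans)
  then have phi: "phi C (model (f (a j)) (g (a j)) y v) < 0" if "j \<in> {1..k}" for j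
    using that k by (subst (asm) Max_less_iff) auto
  have "\<forall>\<^sub>F \<alpha> in at_right 0. h (a j) (y + \<alpha> *\<^sub>R v) \<preceq>\<^bsub>C\<^esub>
           h (a j) y \<oplus> (\<rho> * \<alpha>) \<odot> model (f (a j)) (g (a j)) y v \<and>
         h (a j) (y + \<alpha> *\<^sub>R v) \<prec>\<^bsub>C\<^esub> h (a j) y" if j: "j \<in> {1..k}" for j
  proof -
    have ap: "a j \<in> {1..p}" using part[OF a j] by simp
    \<comment> \<open>An infinite value would make \<open>phi\<close> infinite rather than
      negative.\<close>
    obtain c where c: "g (a j) (y + v) = Fin c"
      using phi[OF j] b[OF ap] by (cases "g (a j) (y + v)") (auto simp: model)
    let ?d = "J (a j) *v v + c - b (a j)"
    have m: "model (f (a j)) (g (a j)) y v = Fin ?d" by (simp add: model c b[OF ap])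
    have d: "- ?d \<in> interior C" using interior_cone_if_phi_neg[OF C] phi[OF j] unfolding m .
    have "\<forall>\<^sub>F \<alpha> in at_right (0::real). \<alpha> \<in> {0<..<1}"
      by (rule eventually_at_right_real) simp
    with eventually_sufficient_decrease[OF C J[OF ap] cvx[OF ap] b[OF ap] c d assms(9)]
    show ?thesis
    proof eventually_elim
      case (elim \<alpha>)
      then have le: "h (a j) (y + \<alpha> *\<^sub>R v) \<preceq>\<^bsub>C\<^esub>
           h (a j) y \<oplus> (\<rho> * \<alpha>) \<odot> model (f (a j)) (g (a j)) y v"
        by (simp add: h[OF ap] m b[OF ap])
      \<comment> \<open>This puts the right-hand side of (i) strictly below the current value, so
        (i) already yields the strict decrease used for (ii).\<close>
      have "(\<rho> * \<alpha>) *\<^sub>R (- ?d) \<in> interior C"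
        using interior_cone_scale[OF C d] assms(8) elim(2) by simp
      then have "h (a j) y \<oplus> (\<rho> * \<alpha>) \<odot> model (f (a j)) (g (a j)) y v \<prec>\<^bsub>C\<^esub> h (a j) y"
        by (simp add: h[OF ap] m b[OF ap] flip: scaleR_minus_right)
      with le show ?case using cle_cless_trans[OF C] by blast
    qed
  qed
  then have "\<forall>\<^sub>F \<alpha> in at_right 0. \<forall>j\<in>{1..k}. h (a j) (y + \<alpha> *\<^sub>R v) \<preceq>\<^bsub>C\<^esub>
           h (a j) y \<oplus> (\<rho> * \<alpha>) \<odot> model (f (a j)) (g (a j)) y v \<and>
         h (a j) (y + \<alpha> *\<^sub>R v) \<prec>\<^bsub>C\<^esub> h (a j) y"
    by (intro eventually_ball_finite) auto
  then obtain \<epsilon> where \<epsilon>: "0 < \<epsilon>" and small: "\<And>\<alpha> j. 0 < \<alpha> \<Longrightarrow> \<alpha> < \<epsilon> \<Longrightarrow> j \<in> {1..k} \<Longrightarrow>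
        h (a j) (y + \<alpha> *\<^sub>R v) \<preceq>\<^bsub>C\<^esub>
           h (a j) y \<oplus> (\<rho> * \<alpha>) \<odot> model (f (a j)) (g (a j)) y v \<and>
         h (a j) (y + \<alpha> *\<^sub>R v) \<prec>\<^bsub>C\<^esub> h (a j) y"
    unfolding eventually_at_right_field by blast
  \<comment> \<open>The bound \<open>\<epsilon>\<close> is common to the finitely many indices
    \<open>j\<close>; capping by 1 keeps the steps in the required range.\<close>
  define I where "I = {0<..<min \<epsilon> 1}"
  have "set_map p h (y + \<alpha> *\<^sub>R v) \<prec>\<^sup>l\<^bsub>C\<^esub> set_map p h y" if \<alpha>: "\<alpha> \<in> I" for \<alpha>
    unfolding set_less_def
  proof
    fix w assume "w \<in> set_map p h y"
    then obtain m where m: "m \<in> minimal_set C (set_map p h y)" "m \<preceq>\<^bsub>C\<^esub> w"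
      using finite_domination[OF C fin] by blast
    then obtain j where j: "j \<in> {1..k}" "m = u y j"
      using u unfolding bij_betw_def by blast
    \<comment> \<open>The index \<open>a j\<close> is active at the minimal element
      \<open>m\<close>, so the decrease of that component starts from \<open>m\<close> and passes to
      every \<open>w\<close> above it.\<close>
    have aj: "a j \<in> {1..p}" "h (a j) y = m" using part[OF a j(1)] j(2) by auto
    have "h (a j) (y + \<alpha> *\<^sub>R v) \<prec>\<^bsub>C\<^esub> m" using small[OF _ _ j(1)] \<alpha> aj(2) by (auto simp: I_def)
    then have "h (a j) (y + \<alpha> *\<^sub>R v) \<prec>\<^bsub>C\<^esub> w" using cless_cle_trans[OF C] m(2) by blast
    then show "\<exists>x\<in>set_map p h (y + \<alpha> *\<^sub>R v). x \<prec>\<^bsub>C\<^esub> w" using aj(1) by (auto simp: set_map_def)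
  qed
  moreover have "\<exists>s\<in>I. \<exists>t\<in>I. s \<noteq> t"
  proof (intro bexI)
    show "min \<epsilon> 1 / 2 \<noteq> min \<epsilon> 1 / 3" "min \<epsilon> 1 / 2 \<in> I" "min \<epsilon> 1 / 3 \<in> I"
      using \<epsilon> by (auto simp: I_def min_def)
  qed
  moreover have "I \<subseteq> {0<..1}" "is_interval I"
    by (auto simp: I_def is_interval_oo)
  moreover have "h (a j) (y + \<alpha> *\<^sub>R v) \<preceq>\<^bsub>C\<^esub>
           h (a j) y \<oplus> (\<rho> * \<alpha>) \<odot> model (f (a j)) (g (a j)) y v"
    if "\<alpha> \<in> I" "j \<in> {1..k}" for \<alpha> j
    using small[of \<alpha> j] that by (simp add: I_def)
  ultimately show ?thesis unfolding k_def by blast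
qed

end
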